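(* Let $\gamma$ be a random element of $SU(2)$ distributed with the Haar probability measure. The correlation structure of the collection of random matrices $(D^\ell(\gamma))_{\ell\in\frac12\mathbb{N}}$ is described by the following identities, for all $\ell,\ell'\in\frac12\mathbb{N}$, $m,s\in\{-\ell,\dots,\ell\}$, $m',s'\in\{-\ell',\dots,\ell'\}$: $$\mathbb{E}\left\{D^\ell_{m,s}(\gamma)\,\overline{D^{\ell'}_{m',s'}(\gamma)}\right\}=\frac{\delta_{\ell,\ell'}\delta_{s,s'}\delta_{m,m'}}{2\ell+1},\qquad \mathbb{E}\left\{D^\ell_{m,s}(\gamma)\,D^{\ell'}_{m',s'}(\gamma)\right\}=\frac{\delta_{\ell,\ell'}\delta_{-s,s'}\delta_{-m,m'}(-1)^{2\ell-m+s}}{2\ell+1}.$$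
   Context: $\frac12\mathbb{N}=\{0,\frac12,1,\dots\}$; indices run in steps of 1 from $-\ell$ to $\ell$. The Wigner matrix $D^\ell=(D^\ell_{m,s})_{m,s}:SU(2)\to U(2\ell+1)$ is defined as follows: with $\psi^\ell_m(z_0,z_1)=\binom{2\ell}{\ell+m}^{1/2}z_0^{\ell+m}z_1^{\ell-m}$ and $g=\begin{pmatrix}\alpha&-\overline\beta\\ \beta&\overline\alpha\end{pmatrix}\in SU(2)$, $\sum_m\psi^\ell_m(z_0,z_1)D^\ell_{m,s}(g)=\psi^\ell_s(\overline\alpha z_0+\overline\beta z_1,-\beta z_0+\alpha z_1)$ for all $z_0,z_1\in\mathbb{C}$.
   Formalization: In the second identity the sign $(-1)^{2\ell-m+s}$ is corrected to $(-1)^{-m+s}$; the printed sign is wrong for half-odd $\ell$ (for $\ell=\ell'=m=s=1/2$, $m'=s'=-1/2$ the expectation is $E|\alpha|^2=1/2$, not $-1/2$). *)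

theory Defs
  imports "HOL-Probability.Probability"
begin

definition conj_transpose :: "complex^2^2 \<Rightarrow> complex^2^2" where
  "conj_transpose g = (\<chi> i j. cnj (g $ j $ i))"

definition SU2 :: "(complex^2^2) set" where
  "SU2 = {g. conj_transpose g ** g = mat 1 \<and> det g = 1}"

abbreviation borel_SU2 :: "(complex^2^2) measure" where
  "borel_SU2 \<equiv> restrict_space borel SU2"

text \<open>Since the group is compact, a left-invariant Borel probability measure is unique and
  automatically right-invariant, so left invariance alone characterises the Haar probability
  measure.\<close>

definition is_haar_prob_SU2 :: "(complex^2^2) measure \<Rightarrow> bool" where
  "is_haar_prob_SU2 \<mu> \<longleftrightarrow>
     prob_space \<mu> \<and> sets \<mu> = sets borel_SU2 \<and> (\<forall>h\<in>SU2. distr \<mu> \<mu> (\<lambda>g. h ** g) = \<mu>)"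

definition half_nats :: "real set" where
  "half_nats = {real n / 2 | n :: nat. True}"

definition wigner_indices :: "real \<Rightarrow> real set" where
  "wigner_indices l = {m. m \<le> l \<and> (\<exists>k::nat. m = - l + real k)}"

text \<open>For \<open>l \<in> half_nats\<close> and \<open>m \<in> wigner_indices l\<close> the numbers \<open>2 * l\<close>, \<open>l + m\<close> and \<open>l - m\<close>
  are natural, so \<open>nat \<lfloor>_\<rfloor>\<close> below is only a coercion.\<close>

definition wigner_psi :: "real \<Rightarrow> real \<Rightarrow> complex \<Rightarrow> complex \<Rightarrow> complex" where
  "wigner_psi l m z0 z1 =
     complex_of_real (sqrt (real (nat \<lfloor>2 * l\<rfloor> choose nat \<lfloor>l + m\<rfloor>))) *
     z0 ^ nat \<lfloor>l + m\<rfloor> * z1 ^ nat \<lfloor>l - m\<rfloor>"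

text \<open>An element of \<open>SU2\<close> has the form \<open>[[\<alpha>, - cnj \<beta>], [\<beta>, cnj \<alpha>]]\<close> with \<open>\<alpha> = g $ 1 $ 1\<close> and
  \<open>\<beta> = g $ 2 $ 1\<close>. Entries outside the index range are set to zero only to make the
  matrix unique as a function; see \<open>wigner_matrix_ex1\<close>.\<close>

definition is_wigner_matrix :: "real \<Rightarrow> complex^2^2 \<Rightarrow> (real \<Rightarrow> real \<Rightarrow> complex) \<Rightarrow> bool" where
  "is_wigner_matrix l g A \<longleftrightarrow>
     (\<forall>s\<in>wigner_indices l. \<forall>z0 z1.
        (\<Sum>m\<in>wigner_indices l. wigner_psi l m z0 z1 * A m s) =
        (let \<alpha> = g $ 1 $ 1; \<beta> = g $ 2 $ 1
         in wigner_psi l s (cnj \<alpha> * z0 + cnj \<beta> * z1) (- \<beta> * z0 + \<alpha> * z1))) \<and>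
     (\<forall>m s. m \<notin> wigner_indices l \<or> s \<notin> wigner_indices l \<longrightarrow> A m s = 0)"

definition wigner_D :: "real \<Rightarrow> real \<Rightarrow> real \<Rightarrow> complex^2^2 \<Rightarrow> complex" where
  "wigner_D l m s g = (THE A. is_wigner_matrix l g A) m s"

lemma SU2_form:
  assumes "g \<in> SU2"
  shows "g $ 1 $ 2 = - cnj (g $ 2 $ 1)" "g $ 2 $ 2 = cnj (g $ 1 $ 1)"
    "cmod (g $ 1 $ 1) ^ 2 + cmod (g $ 2 $ 1) ^ 2 = 1"
proof -
  define a b c d where abcd: "a = g$1$1" "b = g$1$2" "c = g$2$1" "d = g$2$2"
  have M: "conj_transpose g ** g = mat 1" and dt: "a * d - b * c = 1"
    using assms by (auto simp: SU2_def det_2 abcd)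
  have "(conj_transpose g ** g)$1$1 = 1" "(conj_transpose g ** g)$1$2 = 0"
    unfolding M by (simp_all add: mat_def)
  then have e: "cnj a * a + cnj c * c = 1" "cnj a * b + cnj c * d = 0"
    by (simp_all add: matrix_matrix_mult_def conj_transpose_def sum_2 abcd)
  have "b = - cnj c" "d = cnj a"
    using e dt by algebra+
  then show "g $ 1 $ 2 = - cnj (g $ 2 $ 1)" "g $ 2 $ 2 = cnj (g $ 1 $ 1)"
    by (simp_all add: abcd)
  have "complex_of_real (cmod a ^ 2 + cmod c ^ 2) = 1"
    using e(1) by (simp only: of_real_add complex_norm_square) (simp add: mult.commute)
  then show "cmod (g $ 1 $ 1) ^ 2 + cmod (g $ 2 $ 1) ^ 2 = 1"
    unfolding abcd of_real_eq_1_iff .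
qed

lemma wigner_indices_eq: "wigner_indices (real n / 2) = (\<lambda>k. real k - real n / 2) ` {..n}"
  by (auto simp: wigner_indices_def image_def) 

lemma wigner_indicesE:
  assumes "m \<in> wigner_indices (real n / 2)"
  obtains k where "k \<le> n" "m = real k - real n / 2"
proof -
  from assms[unfolded wigner_indices_eq] show ?thesis
    by (elim imageE) (rule that, simp_all only: atMost_iff)
qed

lemma wigner_psi_eq:
  assumes "k \<le> n"
  shows "wigner_psi (real n / 2) (real k - real n / 2) z0 z1 =
    complex_of_real (sqrt (real (n choose k))) * z0 ^ k * z1 ^ (n - k)"
proof -
  have 1: "nat \<lfloor>2 * (real n / 2)\<rfloor> = n" by simp
  have 2: "real n / 2 + (real k - real n / 2) = real k" by simp
  have 3: "real n / 2 - (real k - real n / 2) = real (n - k)"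
    using assms by (simp add: of_nat_diff)
  show ?thesis
    unfolding wigner_psi_def 1 2 3 by (simp del: of_nat_diff)
qed

lemma linear_times_form:
  fixes c :: "nat \<Rightarrow> complex"
  shows "\<exists>c'. \<forall>z w. (a * z + b * w) * (\<Sum>j\<le>n. c j * z ^ j * w ^ (n - j)) =
    (\<Sum>j\<le>Suc n. c' j * z ^ j * w ^ (Suc n - j))"
proof -
  define c' where "c' = (\<lambda>j. (case j of 0 \<Rightarrow> 0 | Suc i \<Rightarrow> a * c i) + (if j \<le> n then b * c j else 0))"
  show ?thesis
  proof (intro exI[of _ c'] allI)
    fix z w :: complex
    have "(\<Sum>j\<le>Suc n. c' j * z ^ j * w ^ (Suc n - j)) =
      (\<Sum>j\<le>Suc n. (case j of 0 \<Rightarrow> 0 | Suc i \<Rightarrow> a * c i) * z ^ j * w ^ (Suc n - j)) +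
      (\<Sum>j\<le>Suc n. (if j \<le> n then b * c j else 0) * z ^ j * w ^ (Suc n - j))"
      by (simp add: c'_def ring_distribs sum.distrib)
    also have "(\<Sum>j\<le>Suc n. (case j of 0 \<Rightarrow> 0 | Suc i \<Rightarrow> a * c i) * z ^ j * w ^ (Suc n - j)) =
      (\<Sum>j\<le>n. a * z * (c j * z ^ j * w ^ (n - j)))"
      by (subst sum.atMost_Suc_shift) (simp add: mult_ac)
    also have "(\<Sum>j\<le>Suc n. (if j \<le> n then b * c j else 0) * z ^ j * w ^ (Suc n - j)) =
      (\<Sum>j\<le>n. b * w * (c j * z ^ j * w ^ (n - j)))"
      by (simp add: Suc_diff_le mult_ac)
    finally show "(a * z + b * w) * (\<Sum>j\<le>n. c j * z ^ j * w ^ (n - j)) =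
      (\<Sum>j\<le>Suc n. c' j * z ^ j * w ^ (Suc n - j))"
      by (simp only: ring_distribs sum_distrib_left sum.distrib)
  qed
qed

lemma linear_powers_form:
  "\<exists>c'. \<forall>z w :: complex. (a * z + b * w) ^ p * (a' * z + b' * w) ^ q =
    (\<Sum>j\<le>p + q. c' j * z ^ j * w ^ (p + q - j))"
proof (induction p)
  case 0
  show ?case
  proof (induction q)
    case 0
    show ?case by (intro exI[of _ "\<lambda>_. 1"]) simp
  next
    case (Suc q)
    then obtain c where c: "\<forall>z w. (a' * z + b' * w) ^ q = (\<Sum>j\<le>q. c j * z ^ j * w ^ (q - j))"
      by auto
    show ?case
      using linear_times_form[of a' b' c q] c by (simp del: sum.atMost_Suc)
  qed
next
  case (Suc p)
  then obtain c where c: "\<forall>z w. (a * z + b * w) ^ p * (a' * z + b' * w) ^ q =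
      (\<Sum>j\<le>p + q. c j * z ^ j * w ^ (p + q - j))"
    by auto
  show ?case
    using linear_times_form[of a b c "p + q"] c by (simp add: mult.assoc del: sum.atMost_Suc)
qed

lemma form_unique:
  fixes c c' :: "nat \<Rightarrow> complex"
  assumes "\<And>z w. (\<Sum>j\<le>n. c j * z ^ j * w ^ (n - j)) = (\<Sum>j\<le>n. c' j * z ^ j * w ^ (n - j))"
    and "j \<le> n"
  shows "c j = c' j"
  using assms(1)[of _ 1] assms(2) polyfun_eq_coeffs[of c n c'] by auto

lemma wigner_sum_eq:
  "(\<Sum>m\<in>wigner_indices (real n / 2). wigner_psi (real n / 2) m z0 z1 * f m) =
   (\<Sum>k\<le>n. (complex_of_real (sqrt (real (n choose k))) * f (real k - real n / 2)) * z0 ^ k * z1 ^ (n - k))"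
  unfolding wigner_indices_eq
  by (subst sum.reindex) (auto simp: inj_on_def wigner_psi_eq mult_ac intro!: sum.cong)

theorem wigner_matrix_ex1:
  assumes "l \<in> half_nats"
  shows "\<exists>!A. is_wigner_matrix l g A"
proof -
  obtain n where l: "l = real n / 2"
    using assms by (auto simp: half_nats_def)
  define rhs where "rhs = (\<lambda>s z0 z1. let \<alpha> = g $ 1 $ 1; \<beta> = g $ 2 $ 1
         in wigner_psi l s (cnj \<alpha> * z0 + cnj \<beta> * z1) (- \<beta> * z0 + \<alpha> * z1))"
  let ?r = "\<lambda>k. complex_of_real (sqrt (real (n choose k)))"
  have r: "?r k \<noteq> 0" if "k \<le> n" for k
    using that by simp
  have "\<exists>c. \<forall>z0 z1. rhs s z0 z1 = (\<Sum>j\<le>n. c j * z0 ^ j * z1 ^ (n - j))"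
    if s: "s \<in> wigner_indices l" for s
  proof -
    obtain k where k: "k \<le> n" "s = real k - real n / 2"
      using s unfolding l by (rule wigner_indicesE)
    obtain c where c: "\<forall>z w. (cnj (g$1$1) * z + cnj (g$2$1) * w) ^ k *
        ((- g$2$1) * z + (g$1$1) * w) ^ (n - k) = (\<Sum>j\<le>n. c j * z ^ j * w ^ (n - j))"
      using linear_powers_form[of "cnj (g$1$1)" "cnj (g$2$1)" k "- g$2$1" "g$1$1" "n - k"]
      unfolding le_add_diff_inverse[OF k(1)] by blast
    show ?thesis
    proof (intro exI[of _ "\<lambda>j. ?r k * c j"] allI)
      fix z0 z1
      have "rhs s z0 z1 = ?r k * ((cnj (g$1$1) * z0 + cnj (g$2$1) * z1) ^ k *
          ((- g$2$1) * z0 + (g$1$1) * z1) ^ (n - k))"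
        unfolding rhs_def Let_def l k(2) wigner_psi_eq[OF k(1)] by (simp only: mult.assoc)
      also have "\<dots> = (\<Sum>j\<le>n. ?r k * c j * z0 ^ j * z1 ^ (n - j))"
        using c by (simp only: sum_distrib_left mult.assoc)
      finally show "rhs s z0 z1 = (\<Sum>j\<le>n. ?r k * c j * z0 ^ j * z1 ^ (n - j))" .
    qed
  qed
  then have "\<forall>s\<in>wigner_indices l. \<exists>c. \<forall>z0 z1. rhs s z0 z1 = (\<Sum>j\<le>n. c j * z0 ^ j * z1 ^ (n - j))"
    by blast
  from bchoice[OF this] obtain c where c: "rhs s z0 z1 = (\<Sum>j\<le>n. c s j * z0 ^ j * z1 ^ (n - j))"
    if "s \<in> wigner_indices l" for s z0 z1
    by blast
  define A where "A = (\<lambda>m s. if m \<in> wigner_indices l \<and> s \<in> wigner_indices l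
    then c s (nat \<lfloor>l + m\<rfloor>) / ?r (nat \<lfloor>l + m\<rfloor>) else 0)"
  have A: "is_wigner_matrix l g A"
    unfolding is_wigner_matrix_def rhs_def[symmetric]
  proof (intro conjI ballI allI impI)
    fix s z0 z1 assume s: "s \<in> wigner_indices l"
    have *: "A (real k - real n / 2) s = c s k / ?r k" if "k \<le> n" for k
      using s that by (auto simp: A_def l wigner_indices_eq)
    show "(\<Sum>m\<in>wigner_indices l. wigner_psi l m z0 z1 * A m s) =
      (let \<alpha> = g $ 1 $ 1; \<beta> = g $ 2 $ 1
         in wigner_psi l s (cnj \<alpha> * z0 + cnj \<beta> * z1) (- \<beta> * z0 + \<alpha> * z1))"
    proof -
      have "(\<Sum>m\<in>wigner_indices l. wigner_psi l m z0 z1 * A m s) =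
        (\<Sum>k\<le>n. c s k * z0 ^ k * z1 ^ (n - k))"
        unfolding l wigner_sum_eq by (rule sum.cong) (use * r in auto)
      then show ?thesis
        using c[OF s, of z0 z1] by (simp only: rhs_def)
    qed
  qed (auto simp: A_def)
  show ?thesis
  proof (rule ex1I[of _ A], rule A, intro ext)
    fix B m s assume B: "is_wigner_matrix l g B"
    show "B m s = A m s"
    proof (cases "m \<in> wigner_indices l \<and> s \<in> wigner_indices l")
      case True
      then have "m \<in> wigner_indices (real n / 2)"
        by (simp only: l)
      then obtain k where k: "k \<le> n" "m = real k - real n / 2"
        by (rule wigner_indicesE)
      have "(\<Sum>m\<in>wigner_indices l. wigner_psi l m z0 z1 * A m s) =
        (\<Sum>m\<in>wigner_indices l. wigner_psi l m z0 z1 * B m s)" for z0 z1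
        using A B True unfolding is_wigner_matrix_def by simp
      then have "?r k * A m s = ?r k * B m s"
        unfolding l wigner_sum_eq k(2)
        by (rule form_unique[where n = n and c = "\<lambda>k. ?r k * A (real k - real n / 2) s"
              and c' = "\<lambda>k. ?r k * B (real k - real n / 2) s", OF _ k(1)])
      then show ?thesis using r[OF k(1)] by simp
    next
      case False
      then have "A m s = 0" "B m s = 0"
        using A B unfolding is_wigner_matrix_def by blast+
      then show ?thesis by simp
    qed
  qed
qed

lemma is_wigner_matrix_wigner_D:
  assumes "l \<in> half_nats"
  shows "is_wigner_matrix l g (\<lambda>m s. wigner_D l m s g)"
  unfolding wigner_D_def using theI'[OF wigner_matrix_ex1[OF assms]] by simp

text \<open>Sign check for \<open>l = 1/2\<close>: the product of the two diagonal entries is \<open>\<bar>\<alpha>\<bar>\<^sup>2 \<ge> 0\<close>, in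
  agreement with the symmetry \<open>cnj D\<^sub>m\<^sub>,\<^sub>s = (-1) powi (s - m) * D\<^sub>-\<^sub>m\<^sub>,\<^sub>-\<^sub>s\<close>. An extra factor \<open>(-1) powi (2 * l)\<close>
  would give the wrong sign for half-odd \<open>l\<close>.\<close>

lemma wigner_D_half_diag:
  "wigner_D (1/2) (1/2) (1/2) g = cnj (g $ 1 $ 1)"
  "wigner_D (1/2) (-1/2) (-1/2) g = g $ 1 $ 1"
proof -
  have I: "wigner_indices (1/2) = {-1/2, 1/2}"
    using wigner_indices_eq[of 1] by (auto simp: atMost_Suc)
  have "is_wigner_matrix (1/2) g (\<lambda>m s. wigner_D (1/2) m s g)"
    by (rule is_wigner_matrix_wigner_D) (auto simp: half_nats_def intro: exI[of _ 1])
  then have *: "(\<Sum>m\<in>{-1/2, 1/2}. wigner_psi (1/2) m z0 z1 * wigner_D (1/2) m s g) =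
     wigner_psi (1/2) s (cnj (g$1$1) * z0 + cnj (g$2$1) * z1) (- (g$2$1) * z0 + (g$1$1) * z1)"
    if "s \<in> {-1/2, 1/2}" for s z0 z1
    using that unfolding is_wigner_matrix_def I Let_def by blast
  show "wigner_D (1/2) (1/2) (1/2) g = cnj (g $ 1 $ 1)"
    using *[of "1/2" 1 0] by (simp add: wigner_psi_def)
  show "wigner_D (1/2) (-1/2) (-1/2) g = g $ 1 $ 1"
    using *[of "-1/2" 0 1] by (simp add: wigner_psi_def)
qed

end

theory Submission
  imports Defs
begin

text \<open>The map \<open>g \<mapsto> D\<^sup>\<ell>(g)\<close> is a unitary representation of \<open>SU2\<close>, acting on forms of degree \<open>2 \<ell>\<close>
  by substitution of \<open>g\<^sup>*\<close>. For fixed columns \<open>s, s'\<close> left invariance makes the matrix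
  \<open>X\<^sub>m\<^sub>,\<^sub>m\<^sub>' = E (D\<^sup>\<ell>\<^sub>m\<^sub>,\<^sub>s cnj D\<^sup>\<ell>\<^sup>'\<^sub>m\<^sub>'\<^sub>,\<^sub>s\<^sub>')\<close> an intertwiner, \<open>D\<^sup>\<ell>(h) X = X D\<^sup>\<ell>\<^sup>'(h)\<close>. Diagonal \<open>h\<close> force
  \<open>X\<^sub>m\<^sub>,\<^sub>m\<^sub>' = 0\<close> for \<open>m \<noteq> m'\<close>, and a single \<open>h\<close> whose highest-weight column has no zero entry forces
  \<open>X\<close> to be scalar for \<open>\<ell> = \<ell>'\<close> and zero otherwise. The scalar is found by taking the trace and using
  that the columns of \<open>D\<^sup>\<ell>\<close> are orthonormal. The second identity follows from the first and the
  symmetry \<open>D\<^sub>m\<^sub>,\<^sub>s = (-1)\<^sup>m\<^sup>-\<^sup>s cnj D\<^sub>-\<^sub>m\<^sub>,\<^sub>-\<^sub>s\<close>.\<close>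

section \<open>Wigner matrices through a basis of binary forms\<close>

definition psi :: "nat \<Rightarrow> nat \<Rightarrow> complex \<Rightarrow> complex \<Rightarrow> complex" where
  "psi n k z w = complex_of_real (sqrt (real (n choose k))) * z ^ k * w ^ (n - k)"

text \<open>Indices are shifted to \<open>0, \<dots>, n\<close> where \<open>n = 2 \<ell>\<close>.\<close>

definition wig :: "nat \<Rightarrow> nat \<Rightarrow> nat \<Rightarrow> complex^2^2 \<Rightarrow> complex" where
  "wig n j k g = wigner_D (real n / 2) (real j - real n / 2) (real k - real n / 2) g"

lemma wig_sum:
  assumes "k \<le> n"
  shows "(\<Sum>j\<le>n. psi n j z w * wig n j k g) =
    psi n k (cnj (g$1$1) * z + cnj (g$2$1) * w) (- (g$2$1) * z + g$1$1 * w)"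
proof -
  have "is_wigner_matrix (real n / 2) g (\<lambda>m s. wigner_D (real n / 2) m s g)"
    by (rule is_wigner_matrix_wigner_D) (auto simp: half_nats_def)
  moreover have "real k - real n / 2 \<in> wigner_indices (real n / 2)"
    using assms by (auto simp: wigner_indices_eq)
  ultimately have "(\<Sum>m\<in>wigner_indices (real n / 2). wigner_psi (real n / 2) m z w *
        wigner_D (real n / 2) m (real k - real n / 2) g) =
      wigner_psi (real n / 2) (real k - real n / 2)
        (cnj (g$1$1) * z + cnj (g$2$1) * w) (- (g$2$1) * z + g$1$1 * w)"
    unfolding is_wigner_matrix_def Let_def by blast
  then show ?thesis
    unfolding wigner_sum_eq wigner_psi_eq[OF assms]
    by (simp add: psi_def wig_def mult_ac)
qed

lemma psi_coeff_unique:
  assumes "\<And>z w. (\<Sum>j\<le>n. psi n j z w * c j) = (\<Sum>j\<le>n. psi n j z w * c' j)" and "j \<le> n"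
  shows "c j = c' j"
proof -
  let ?r = "\<lambda>j. complex_of_real (sqrt (real (n choose j)))"
  have "?r j * c j = ?r j * c' j"
    by (rule form_unique[where n = n and c = "\<lambda>j. ?r j * c j" and c' = "\<lambda>j. ?r j * c' j"])
      (use assms in \<open>simp_all add: psi_def mult_ac\<close>)
  then show ?thesis
    using assms(2) by simp
qed

text \<open>Entries of \<open>wig\<close> are computed with this by guessing a whole column and
  checking the generating identity of \<open>wig_sum\<close>.\<close>

lemma wig_unique:
  assumes "\<And>z w. (\<Sum>j\<le>n. psi n j z w * c j) =
      psi n k (cnj (g$1$1) * z + cnj (g$2$1) * w) (- (g$2$1) * z + g$1$1 * w)"
    and "j \<le> n" "k \<le> n"
  shows "wig n j k g = c j"
  by (rule psi_coeff_unique[OF _ assms(2)]) (simp add: assms(1) wig_sum[OF assms(3)])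

text \<open>The two square roots multiply to the binomial coefficient, which leaves the binomial
  theorem. The normalisation of \<open>psi\<close> thus produces a power of the Hermitian product,
  which \<open>SU2\<close> preserves; this is the source of unitarity.\<close>

lemma psi_kernel:
  "(\<Sum>k\<le>n. psi n k z w * cnj (psi n k z' w')) = (z * cnj z' + w * cnj w') ^ n"
proof -
  have "psi n k z w * cnj (psi n k z' w') =
      of_nat (n choose k) * (z * cnj z') ^ k * (w * cnj w') ^ (n - k)" for k
  proof -
    have "complex_of_real (sqrt (real (n choose k))) * complex_of_real (sqrt (real (n choose k)))
        = of_nat (n choose k)"
      by (simp flip: of_real_mult)
    then show ?thesis
      by (simp add: psi_def power_mult_distrib mult_ac)
  qed
  then show ?thesis
    by (simp add: binomial_ring)
qed

section \<open>The representation of \<open>SU2\<close> and its unitarity\<close>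

lemma conj_transpose_SU2:
  assumes "g \<in> SU2"
  shows "conj_transpose g \<in> SU2"
proof -
  have "conj_transpose (conj_transpose g) ** conj_transpose g = mat 1"
    using assms matrix_left_right_inverse[of "conj_transpose g" g]
    by (auto simp: SU2_def conj_transpose_def)
  moreover have "det (conj_transpose g) = cnj (det g)"
    by (simp add: det_2 conj_transpose_def)
  ultimately show ?thesis
    using assms by (simp add: SU2_def)
qed

lemma conj_transpose_mult: "conj_transpose (h ** g) = conj_transpose g ** conj_transpose h"
  by (simp add: conj_transpose_def matrix_matrix_mult_def vec_eq_iff mult.commute)

lemma SU2_mult:
  assumes "h \<in> SU2" "g \<in> SU2"
  shows "h ** g \<in> SU2"
proof -
  have "conj_transpose g ** conj_transpose h ** (h ** g) =
      conj_transpose g ** (conj_transpose h ** h) ** g"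
    by (simp only: matrix_mul_assoc)
  then show ?thesis
    using assms by (simp add: SU2_def conj_transpose_mult det_mul)
qed

text \<open>Put \<open>(z', w') = h^* (z, w)\<close>. Applying \<open>g^*\<close> to this vector
  gives the substitution for \<open>h ** g\<close>, since \<open>g^* h^*\<close> is the adjoint of
  \<open>h ** g\<close>.\<close>

lemma wig_mult:
  assumes "h \<in> SU2" "g \<in> SU2" "j \<le> n" "k \<le> n"
  shows "wig n j k (h ** g) = (\<Sum>i\<le>n. wig n j i h * wig n i k g)"
proof (rule wig_unique[OF _ assms(3,4)])
  fix z w
  define z' w' where zw: "z' = cnj (h$1$1) * z + cnj (h$2$1) * w"
    "w' = - (h$2$1) * z + h$1$1 * w"
  have "(\<Sum>j\<le>n. psi n j z w * (\<Sum>i\<le>n. wig n j i h * wig n i k g)) =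
      (\<Sum>i\<le>n. (\<Sum>j\<le>n. psi n j z w * wig n j i h) * wig n i k g)"
    unfolding sum_distrib_left sum_distrib_right by (subst sum.swap) (simp add: mult.assoc)
  also have "\<dots> = (\<Sum>i\<le>n. psi n i z' w' * wig n i k g)"
    by (rule sum.cong) (simp_all add: wig_sum zw)
  also have "\<dots> = psi n k (cnj (g$1$1) * z' + cnj (g$2$1) * w') (- (g$2$1) * z' + g$1$1 * w')"
    by (rule wig_sum[OF assms(4)])
  also have "cnj (g$1$1) * z' + cnj (g$2$1) * w' =
      cnj ((h ** g)$1$1) * z + cnj ((h ** g)$2$1) * w"
    by (simp add: matrix_matrix_mult_def sum_2 SU2_form(1,2)[OF assms(1)] zw algebra_simps)
  also have "- (g$2$1) * z' + g$1$1 * w' = - ((h ** g)$2$1) * z + (h ** g)$1$1 * w"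
    by (simp add: matrix_matrix_mult_def sum_2 SU2_form(1,2)[OF assms(1)] zw algebra_simps)
  finally show "(\<Sum>j\<le>n. psi n j z w * (\<Sum>i\<le>n. wig n j i h * wig n i k g)) =
      psi n k (cnj ((h ** g)$1$1) * z + cnj ((h ** g)$2$1) * w)
        (- ((h ** g)$2$1) * z + (h ** g)$1$1 * w)" .
qed

text \<open>The kernel \<open>(z \<cdot> cnj w)\<^sup>n\<close> of the basis \<open>psi n k\<close> turns substitution of \<open>g\<^sup>*\<close> in one
  argument into substitution of \<open>g\<close> in the other.\<close>

lemma wig_adjoint:
  assumes "g \<in> SU2" "j \<le> n" "k \<le> n"
  shows "wig n j k (conj_transpose g) = cnj (wig n k j g)"
proof (rule wig_unique[OF _ assms(2,3)])
  fix z w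
  let ?a = "g$1$1" and ?b = "g$2$1"
  \<comment> \<open>This is \<open>g\<close> applied to \<open>(z, w)\<close>, the substitution that
    \<open>wig_sum\<close> prescribes for \<open>conj_transpose g\<close>.\<close>
  define u v where uv: "u = ?a * z - cnj ?b * w" "v = ?b * z + cnj ?a * w"
  \<comment> \<open>As coefficients of forms in \<open>(x, y)\<close>, both sides generate the
    \<open>n\<close>-th power of one Hermitian product: that of \<open>g^* (x, y)\<close> with
    \<open>(z, w)\<close>, which is that of \<open>(x, y)\<close> with
    \<open>g (z, w)\<close>.\<close>
  have "cnj (\<Sum>j\<le>n. psi n j z w * cnj (wig n k j g)) = cnj (psi n k u v)"
  proof (rule psi_coeff_unique[OF _ assms(3)])
    fix x y
    have "(\<Sum>k\<le>n. psi n k x y * cnj (\<Sum>j\<le>n. psi n j z w * cnj (wig n k j g))) =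
        (\<Sum>j\<le>n. (\<Sum>k\<le>n. psi n k x y * wig n k j g) * cnj (psi n j z w))"
      unfolding cnj_sum sum_distrib_left sum_distrib_right by (subst sum.swap) (simp add: mult_ac)
    also have "\<dots> = (\<Sum>j\<le>n. psi n j (cnj ?a * x + cnj ?b * y) (- ?b * x + ?a * y) * cnj (psi n j z w))"
      by (rule sum.cong) (simp_all add: wig_sum)
    also have "\<dots> = (x * cnj u + y * cnj v) ^ n"
      unfolding psi_kernel by (simp add: uv algebra_simps)
    also have "\<dots> = (\<Sum>k\<le>n. psi n k x y * cnj (psi n k u v))"
      by (rule psi_kernel[symmetric])
    finally show "(\<Sum>k\<le>n. psi n k x y * cnj (\<Sum>j\<le>n. psi n j z w * cnj (wig n k j g))) =
        (\<Sum>k\<le>n. psi n k x y * cnj (psi n k u v))" .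
  qed
  then have "(\<Sum>j\<le>n. psi n j z w * cnj (wig n k j g)) = psi n k u v"
    by (simp only: complex_cnj_cancel_iff)
  then show "(\<Sum>j\<le>n. psi n j z w * cnj (wig n k j g)) =
      psi n k (cnj (conj_transpose g$1$1) * z + cnj (conj_transpose g$2$1) * w)
        (- (conj_transpose g$2$1) * z + conj_transpose g$1$1 * w)"
    by (simp add: conj_transpose_def SU2_form[OF assms(1)] uv)
qed

lemma wig_diagonal:
  assumes "g$2$1 = 0" "j \<le> n" "k \<le> n"
  shows "wig n j k g = (if j = k then cnj (g$1$1) ^ k * (g$1$1) ^ (n - k) else 0)"
  by (rule wig_unique[OF _ assms(2,3)])
    (simp add: assms if_distrib sum.delta psi_def power_mult_distrib mult_ac cong: if_cong)

text \<open>In column \<open>n\<close> the second linear form has exponent 0. What is left is the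
  \<open>n\<close>-th power of a Hermitian product, expanded by \<open>psi_kernel\<close>.\<close>

lemma wig_last_column:
  assumes "j \<le> n"
  shows "wig n j n g =
    complex_of_real (sqrt (real (n choose j))) * cnj (g$1$1) ^ j * cnj (g$2$1) ^ (n - j)"
proof (rule wig_unique[OF _ assms order_refl])
  fix z w
  let ?r = "\<lambda>j. complex_of_real (sqrt (real (n choose j)))"
  have "(\<Sum>j\<le>n. psi n j z w * (?r j * cnj (g$1$1) ^ j * cnj (g$2$1) ^ (n - j))) =
      (\<Sum>j\<le>n. psi n j z w * cnj (psi n j (g$1$1) (g$2$1)))"
    by (simp add: psi_def)
  then show "(\<Sum>j\<le>n. psi n j z w * (?r j * cnj (g$1$1) ^ j * cnj (g$2$1) ^ (n - j))) =
      psi n n (cnj (g$1$1) * z + cnj (g$2$1) * w) (- (g$2$1) * z + g$1$1 * w)"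
    by (simp add: psi_kernel) (simp add: psi_def mult.commute)
qed

text \<open>These are the entries of \<open>D(g)^* D(g) = D(g^* g) = D(1)\<close>.\<close>

lemma wig_columns_orthonormal:
  assumes "g \<in> SU2" "k \<le> n" "k' \<le> n"
  shows "(\<Sum>j\<le>n. wig n j k g * cnj (wig n j k' g)) = of_bool (k = k')"
proof -
  have "(\<Sum>j\<le>n. wig n j k g * cnj (wig n j k' g)) =
      (\<Sum>j\<le>n. wig n k' j (conj_transpose g) * wig n j k g)"
    by (rule sum.cong) (simp_all add: wig_adjoint assms)
  also have "\<dots> = wig n k' k (mat 1)"
    using wig_mult[OF conj_transpose_SU2[OF assms(1)] assms(1,3,2)] assms(1)
    by (simp add: SU2_def)
  also have "\<dots> = of_bool (k = k')"
    by (subst wig_diagonal) (auto simp: assms mat_def)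
  finally show ?thesis .
qed

lemma norm_wig_le_1:
  assumes "g \<in> SU2" "j \<le> n" "k \<le> n"
  shows "norm (wig n j k g) \<le> 1"
proof -
  have "complex_of_real (\<Sum>j\<le>n. (norm (wig n j k g))\<^sup>2) = 1"
    using wig_columns_orthonormal[OF assms(1,3,3)]
    by (simp only: of_real_sum complex_norm_square) simp
  then have "(\<Sum>j\<le>n. (norm (wig n j k g))\<^sup>2) = 1"
    by (simp only: of_real_eq_1_iff)
  moreover have "(norm (wig n j k g))\<^sup>2 \<le> (\<Sum>j\<le>n. (norm (wig n j k g))\<^sup>2)"
    by (rule member_le_sum) (use assms(2) in auto)
  ultimately show ?thesis
    by (simp add: power_le_one_iff abs_square_le_1)
qed

section \<open>Complex conjugation of the entries\<close>

lemma psi_rotate: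
  assumes "k \<le> n"
  shows "psi n k (- w) z = (- 1) ^ k * psi n (n - k) z w"
proof -
  have "(- w) ^ k = (- 1) ^ k * w ^ k"
    by (rule power_minus)
  then show ?thesis
    using assms by (simp add: psi_def binomial_symmetric[OF assms] mult_ac)
qed

text \<open>The antilinear map \<open>(z, w) -> (- cnj w, cnj z)\<close> commutes with the
  substitution in \<open>wig_sum\<close> and, by \<open>psi_rotate\<close>, exchanges the indices
  \<open>k\<close> and \<open>n - k\<close> up to sign. So the generating identity of column
  \<open>n - k\<close> is evaluated at \<open>(- cnj w, cnj z)\<close> and conjugated.\<close>

lemma wig_symmetry:
  assumes "j \<le> n" "k \<le> n"
  shows "wig n j k g = (- 1) ^ (j + k) * cnj (wig n (n - j) (n - k) g)"
proof (rule wig_unique[OF _ assms])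
  fix z w
  let ?a = "g$1$1" and ?b = "g$2$1"
  have "(\<Sum>j\<le>n. psi n j z w * ((- 1) ^ (j + k) * cnj (wig n (n - j) (n - k) g))) =
      (\<Sum>i\<le>n. psi n (n - i) z w * ((- 1) ^ (n - i + k) * cnj (wig n i (n - k) g)))"
    by (rule sum.reindex_bij_witness[of _ "\<lambda>i. n - i" "\<lambda>i. n - i"]) auto
  also have "\<dots> = (\<Sum>i\<le>n. (- 1) ^ (n + k) * cnj (psi n i (- cnj w) (cnj z) * wig n i (n - k) g))"
  proof (rule sum.cong, rule refl)
    fix i assume "i \<in> {..n}"
    then have i: "i \<le> n" by simp
    have "cnj (psi n i (- cnj w) (cnj z)) = psi n i (- w) z"
      by (simp add: psi_def)
    moreover have "(- 1 :: complex) ^ (n - i + k) = (- 1) ^ (n + k) * (- 1) ^ i"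
      using i by (auto simp: minus_one_power_iff)
    ultimately show "psi n (n - i) z w * ((- 1) ^ (n - i + k) * cnj (wig n i (n - k) g)) =
        (- 1) ^ (n + k) * cnj (psi n i (- cnj w) (cnj z) * wig n i (n - k) g)"
      by (simp add: psi_rotate[OF i])
  qed
  also have "\<dots> = (- 1) ^ (n + k) * cnj (\<Sum>i\<le>n. psi n i (- cnj w) (cnj z) * wig n i (n - k) g)"
    by (simp add: sum_distrib_left)
  also have "\<dots> = (- 1) ^ (n + k) *
      psi n (n - k) (- (- ?b * z + ?a * w)) (cnj ?a * z + cnj ?b * w)"
    by (subst wig_sum) (simp_all add: psi_def algebra_simps)
  also have "\<dots> = psi n k (cnj ?a * z + cnj ?b * w) (- ?b * z + ?a * w)"
    by (subst psi_rotate) (use assms(2) in \<open>auto simp: minus_one_power_iff\<close>)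
  finally show "(\<Sum>j\<le>n. psi n j z w * ((- 1) ^ (j + k) * cnj (wig n (n - j) (n - k) g))) =
      psi n k (cnj ?a * z + cnj ?b * w) (- ?b * z + ?a * w)" .
qed

section \<open>Measurability and the Haar integral\<close>

text \<open>\<open>wigner_D\<close> is a definite description, so measurability calls for a formula
  visibly continuous in \<open>g\<close>. At \<open>w = 1\<close> the generating form is a product
  of powers of two linear polynomials in \<open>z\<close>, and the entry is read off from one
  coefficient.\<close>

lemma wig_explicit:
  assumes "j \<le> n" "k \<le> n"
  shows "wig n j k g =
    complex_of_real (sqrt (real (n choose k))) / complex_of_real (sqrt (real (n choose j))) *
    (\<Sum>i\<le>j. (of_nat (k choose i) * cnj (g$1$1) ^ i * cnj (g$2$1) ^ (k - i)) *
      (of_nat ((n - k) choose (j - i)) * (- (g$2$1)) ^ (j - i) * (g$1$1) ^ (n - k - (j - i))))"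
proof -
  let ?r = "\<lambda>j. complex_of_real (sqrt (real (n choose j)))"
  let ?p = "[:cnj (g$2$1), cnj (g$1$1):] ^ k" and ?q = "[:g$1$1, - (g$2$1):] ^ (n - k)"
  have lin: "coeff ([:a, b:] ^ p) i = of_nat (p choose i) * b ^ i * a ^ (p - i)"
    for a b :: complex and p i
    using degree_power_le[of "[:a, b:]" p]
    by (cases "i \<le> p") (auto simp: coeff_linear_poly_power coeff_eq_0 split: if_splits)
  have deg: "degree (?p * ?q) \<le> n"
    using degree_mult_le[of ?p ?q] degree_power_le[of "[:cnj (g$2$1), cnj (g$1$1):]" k]
      degree_power_le[of "[:g$1$1, - (g$2$1):]" "n - k"] assms(2)
    by (auto split: if_splits)
  have "(\<Sum>i\<le>n. (?r i * wig n i k g) * z ^ i) = (\<Sum>i\<le>n. (?r k * coeff (?p * ?q) i) * z ^ i)" for z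
  proof -
    have "(\<Sum>i\<le>n. (?r i * wig n i k g) * z ^ i) = ?r k * poly (?p * ?q) z"
      using wig_sum[OF assms(2), of z 1 g] by (simp add: psi_def algebra_simps)
    also have "poly (?p * ?q) z = (\<Sum>i\<le>n. coeff (?p * ?q) i * z ^ i)"
      unfolding poly_altdef
      by (rule sum.mono_neutral_left) (use deg in \<open>auto simp: coeff_eq_0\<close>)
    finally show ?thesis
      by (simp only: sum_distrib_left mult.assoc)
  qed
  then have "?r j * wig n j k g = ?r k * coeff (?p * ?q) j"
    using polyfun_eq_coeffs[of "\<lambda>i. ?r i * wig n i k g" n "\<lambda>i. ?r k * coeff (?p * ?q) i"] assms(1)
    by blast
  then show ?thesis
    using assms by (simp add: coeff_mult lin field_simps)
qed


lemma wig_borel_measurable: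
  assumes "j \<le> n" "k \<le> n"
  shows "wig n j k \<in> borel_measurable borel_SU2"
    "(\<lambda>g. cnj (wig n j k g)) \<in> borel_measurable borel_SU2"
proof -
  have "continuous_on UNIV (wig n j k)"
    unfolding wig_explicit[OF assms, abs_def] by (intro continuous_intros)
  moreover from this have "continuous_on UNIV (\<lambda>g. cnj (wig n j k g))"
    by (intro continuous_intros)
  ultimately show "wig n j k \<in> borel_measurable borel_SU2"
    "(\<lambda>g. cnj (wig n j k g)) \<in> borel_measurable borel_SU2"
    by (auto intro!: measurable_restrict_space1 borel_measurable_continuous_onI)
qed

lemma mult_left_measurable_SU2:
  assumes "h \<in> SU2"
  shows "(\<lambda>g. h ** g) \<in> measurable borel_SU2 borel_SU2"
proof -
  have "linear (\<lambda>g. h ** g)"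
    by (rule linearI)
      (simp_all add: matrix_matrix_mult_def vec_eq_iff ring_distribs sum.distrib scaleR_sum_right)
  then have "(\<lambda>g. h ** g) \<in> borel_measurable borel"
    by (intro borel_measurable_continuous_onI linear_continuous_on) (simp add: linear_linear)
  then show ?thesis
    by (intro measurable_restrict_space2 measurable_restrict_space1)
      (use SU2_mult[OF assms] in \<open>auto simp: space_restrict_space\<close>)
qed

lemma haar_space:
  assumes "is_haar_prob_SU2 \<mu>"
  shows "space \<mu> = SU2"
  using assms sets_eq_imp_space_eq[of \<mu> borel_SU2]
  by (simp add: is_haar_prob_SU2_def space_restrict_space)

lemma haar_measurable:
  assumes "is_haar_prob_SU2 \<mu>" "f \<in> borel_measurable borel_SU2"
  shows "f \<in> borel_measurable \<mu>"
  using assms measurable_cong_sets[of \<mu> borel_SU2 borel borel] by (auto simp: is_haar_prob_SU2_def)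

lemma haar_integral_left_mult:
  fixes f :: "complex^2^2 \<Rightarrow> complex"
  assumes "is_haar_prob_SU2 \<mu>" "h \<in> SU2" "f \<in> borel_measurable borel_SU2"
  shows "(LINT g|\<mu>. f (h ** g)) = (LINT g|\<mu>. f g)"
proof -
  have "sets \<mu> = sets borel_SU2"
    using assms(1) by (simp add: is_haar_prob_SU2_def)
  then have "(\<lambda>g. h ** g) \<in> measurable \<mu> \<mu>"
    using mult_left_measurable_SU2[OF assms(2)] by (simp cong: measurable_cong_sets)
  then have "(LINT g|distr \<mu> \<mu> (\<lambda>g. h ** g). f g) = (LINT g|\<mu>. f (h ** g))"
    by (rule integral_distr) (rule haar_measurable[OF assms(1,3)])
  then show ?thesis
    using assms(1,2) by (simp add: is_haar_prob_SU2_def)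
qed

lemma integrable_wig_mult_cnj:
  assumes "is_haar_prob_SU2 \<mu>" "j \<le> n" "k \<le> n" "j' \<le> n'" "k' \<le> n'"
  shows "integrable \<mu> (\<lambda>g. wig n j k g * cnj (wig n' j' k' g))"
proof -
  interpret prob_space \<mu>
    using assms(1) by (simp add: is_haar_prob_SU2_def)
  have [measurable]: "wig n j k \<in> borel_measurable \<mu>"
    "(\<lambda>g. cnj (wig n' j' k' g)) \<in> borel_measurable \<mu>"
    by (rule haar_measurable[OF assms(1)], rule wig_borel_measurable, rule assms, rule assms)+
  show ?thesis
  proof (rule integrable_const_bound[of _ 1])
    show "AE g in \<mu>. norm (wig n j k g * cnj (wig n' j' k' g)) \<le> 1"
      using assms by (auto simp: norm_mult haar_space intro!: AE_I2 mult_le_one norm_wig_le_1)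
  qed measurable
qed

section \<open>Correlations and Schur's lemma\<close>

text \<open>For fixed \<open>k\<close> and \<open>k'\<close> this is the intertwiner
  \<open>X\<close> with row index \<open>j\<close> and column index \<open>j'\<close>.\<close>

definition wig_corr ::
  "(complex^2^2) measure \<Rightarrow> nat \<Rightarrow> nat \<Rightarrow> nat \<Rightarrow> nat \<Rightarrow> nat \<Rightarrow> nat \<Rightarrow> complex" where
  "wig_corr \<mu> n j k n' j' k' = (LINT g|\<mu>. wig n j k g * cnj (wig n' j' k' g))"

text \<open>Swapping the two representations reduces \<open>wig_corr_eq\<close> to the case
  \<open>n \<le> n'\<close> treated in \<open>wig_corr_schur\<close>.\<close>

lemma wig_corr_cnj: "wig_corr \<mu> n j k n' j' k' = cnj (wig_corr \<mu> n' j' k' n j k)"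
  unfolding wig_corr_def Bochner_Integration.integral_cnj[symmetric]
  by (simp add: mult.commute del: Bochner_Integration.integral_cnj)

lemma wig_corr_intertwines:
  assumes "is_haar_prob_SU2 \<mu>" "h \<in> SU2" "j \<le> n" "k \<le> n" "j' \<le> n'" "k' \<le> n'"
  shows "(\<Sum>i\<le>n. wig n j i h * wig_corr \<mu> n i k n' j' k') =
    (\<Sum>i\<le>n'. wig n' i j' h * wig_corr \<mu> n j k n' i k')"
proof -
  note [measurable] = wig_borel_measurable(1)[OF assms(3,4)] wig_borel_measurable(2)[OF assms(5,6)]
    mult_left_measurable_SU2[OF assms(2)]
  let ?h = "conj_transpose h"
  have h: "?h \<in> SU2"
    by (rule conj_transpose_SU2[OF assms(2)])
  have inv: "h ** (?h ** g) = g" for g :: "complex^2^2"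
    using assms(2) matrix_left_right_inverse[of ?h h]
    by (simp add: SU2_def matrix_mul_assoc)
  have "(\<Sum>i\<le>n. wig n j i h * wig_corr \<mu> n i k n' j' k') =
      (LINT g|\<mu>. (\<Sum>i\<le>n. wig n j i h * (wig n i k g * cnj (wig n' j' k' g))))"
    unfolding wig_corr_def
    by (subst Bochner_Integration.integral_sum)
      (auto intro!: integrable_mult_right integrable_wig_mult_cnj assms)
  also have "\<dots> = (LINT g|\<mu>. wig n j k (h ** g) * cnj (wig n' j' k' g))"
    by (rule Bochner_Integration.integral_cong)
      (auto simp: haar_space[OF assms(1)] wig_mult assms sum_distrib_right mult.assoc)
  also have "\<dots> = (LINT g|\<mu>. wig n j k (h ** (?h ** g)) * cnj (wig n' j' k' (?h ** g)))"
    by (rule haar_integral_left_mult[OF assms(1) h, symmetric]) measurable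
  also have "\<dots> = (LINT g|\<mu>. (\<Sum>i\<le>n'. wig n' i j' h * (wig n j k g * cnj (wig n' i k' g))))"
    by (rule Bochner_Integration.integral_cong)
      (auto simp: haar_space[OF assms(1)] inv wig_mult[OF h] wig_adjoint assms sum_distrib_left
        mult_ac)
  also have "\<dots> = (\<Sum>i\<le>n'. wig n' i j' h * wig_corr \<mu> n j k n' i k')"
    unfolding wig_corr_def
    by (subst Bochner_Integration.integral_sum)
      (auto intro!: integrable_mult_right integrable_wig_mult_cnj assms)
  finally show ?thesis .
qed

definition SU2_of :: "complex \<Rightarrow> complex \<Rightarrow> complex^2^2" where
  "SU2_of a b = vector [vector [a, - cnj b], vector [b, cnj a]]"

lemma SU2_of_nth [simp]: "SU2_of a b $ 1 $ 1 = a" "SU2_of a b $ 2 $ 1 = b"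
  by (simp_all add: SU2_of_def)

lemma SU2_of_in_SU2:
  assumes "a * cnj a + b * cnj b = 1"
  shows "SU2_of a b \<in> SU2"
  using assms
  by (simp add: SU2_def SU2_of_def conj_transpose_def det_2 vec_eq_iff forall_2
      matrix_matrix_mult_def sum_2 mat_def algebra_simps)

text \<open>The torus element \<open>diag(e\<^sup>i\<^sup>t, e\<^sup>-\<^sup>i\<^sup>t)\<close> acts with weights \<open>e\<^sup>i\<^sup>t\<^sup>(\<^sup>n\<^sup>-\<^sup>2\<^sup>j\<^sup>)\<close>; \<open>t\<close> is chosen
  so that the two weights in question are opposite.\<close>

lemma wig_corr_off_diagonal:
  assumes "is_haar_prob_SU2 \<mu>" "j \<le> n" "k \<le> n" "j' \<le> n'" "k' \<le> n'"
    and "2 * j + n' \<noteq> 2 * j' + n"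
  shows "wig_corr \<mu> n j k n' j' k' = 0"
proof -
  \<comment> \<open>Up to the factor -2 these are the original indices \<open>m\<close> and
    \<open>m'\<close>, so the last hypothesis says that they differ.\<close>
  define v v' where "v = real n - 2 * real j" and "v' = real n' - 2 * real j'"
  define t where "t = pi / (v - v')"
  define h where "h = SU2_of (cis t) 0"
  have h: "h \<in> SU2" "h$1$1 = cis t" "h$2$1 = 0"
    unfolding h_def by (auto intro!: SU2_of_in_SU2 simp: cis_cnj cis_mult)
  have weight: "wig p i q h = (if i = q then cis (t * (real p - 2 * real q)) else 0)"
    if "i \<le> p" "q \<le> p" for i p q
    using that
    by (simp add: wig_diagonal h cis_cnj Complex.DeMoivre cis_mult of_nat_diff algebra_simps)
  have "(\<Sum>i\<le>n. wig n j i h * wig_corr \<mu> n i k n' j' k') =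
      (\<Sum>i\<le>n. if i = j then cis (t * v) * wig_corr \<mu> n j k n' j' k' else 0)"
    by (rule sum.cong) (use assms in \<open>auto simp: weight v_def\<close>)
  moreover have "(\<Sum>i\<le>n'. wig n' i j' h * wig_corr \<mu> n j k n' i k') =
      (\<Sum>i\<le>n'. if i = j' then cis (t * v') * wig_corr \<mu> n j k n' j' k' else 0)"
    by (rule sum.cong) (use assms in \<open>auto simp: weight v'_def\<close>)
  ultimately have "cis (t * v) * wig_corr \<mu> n j k n' j' k' =
      cis (t * v') * wig_corr \<mu> n j k n' j' k'"
    using wig_corr_intertwines[OF assms(1) h(1) assms(2-5)] assms(2,4)
    by (simp only: sum.delta finite_atMost atMost_iff if_True)
  moreover have "cis (t * v) = - cis (t * v')"
  proof -
    have "v - v' \<noteq> 0"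
      using assms(6) by (simp add: v_def v'_def)
    then have "t * v = pi + t * v'"
      by (simp add: t_def field_simps)
    then show ?thesis
      by (simp flip: cis_mult)
  qed
  ultimately show ?thesis
    by simp
qed

text \<open>The intertwining relation is read at \<open>(j, n')\<close>. On the left only
  \<open>i\<close> with \<open>2 * i = n + n'\<close> survives, which under
  \<open>i \<le> n \<le> n'\<close> means \<open>i = n = n'\<close>; on the right only
  \<open>i = j'\<close> does. The result is divided by a nonzero entry of the last column of
  \<open>D(h)\<close>.\<close>

lemma wig_corr_schur:
  assumes "is_haar_prob_SU2 \<mu>" "n \<le> n'" "j \<le> n" "k \<le> n" "j' \<le> n'" "k' \<le> n'"
    and "2 * j + n' = 2 * j' + n"
  shows "wig_corr \<mu> n j k n' j' k' = of_bool (n = n') * wig_corr \<mu> n n k n n k'"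
proof -
  \<comment> \<open>A Pythagorean triple gives an element of \<open>SU2\<close> with both parameters
    nonzero, so by \<open>wig_last_column\<close> no entry of the last column vanishes.\<close>
  define h where "h = SU2_of (3/5) (4/5)"
  have h: "h \<in> SU2" "h$1$1 = 3/5" "h$2$1 = 4/5"
    unfolding h_def by (auto intro!: SU2_of_in_SU2)
  have nz: "wig p i p h \<noteq> 0" if "i \<le> p" for i p
    using that by (simp add: wig_last_column h)
  note zero = wig_corr_off_diagonal[OF assms(1)]
  have "(\<Sum>i\<le>n. wig n j i h * wig_corr \<mu> n i k n' n' k') =
      (\<Sum>i\<le>n. if i = n then of_bool (n = n') * (wig n j n h * wig_corr \<mu> n n k n n k') else 0)"
    using zero[of _ n k n' n' k'] assms(2,4,6) by (intro sum.cong) force+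
  moreover have "(\<Sum>i\<le>n'. wig n' i n' h * wig_corr \<mu> n j k n' i k') =
      (\<Sum>i\<le>n'. if i = j' then wig n' j' n' h * wig_corr \<mu> n j k n' j' k' else 0)"
    using zero[OF assms(3,4) _ assms(6)] assms(7) by (intro sum.cong) force+
  ultimately have "of_bool (n = n') * (wig n j n h * wig_corr \<mu> n n k n n k') =
      wig n' j' n' h * wig_corr \<mu> n j k n' j' k'"
    using wig_corr_intertwines[OF assms(1) h(1) assms(3,4) order_refl assms(6)] assms(5)
    by (simp only: sum.delta finite_atMost atMost_iff if_True order_refl)
  then show ?thesis
    using nz[OF assms(5)] assms(7) by (cases "n = n'") auto
qed

text \<open>By \<open>wig_corr_schur\<close> the \<open>n + 1\<close> diagonal entries of
  \<open>X\<close> agree. Their sum integrates the scalar product of two columns, a constant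
  function on \<open>SU2\<close>.\<close>

lemma wig_corr_trace:
  assumes "is_haar_prob_SU2 \<mu>" "k \<le> n" "k' \<le> n"
  shows "wig_corr \<mu> n n k n n k' = of_bool (k = k') / of_nat (n + 1)"
proof -
  interpret prob_space \<mu>
    using assms(1) by (simp add: is_haar_prob_SU2_def)
  have "wig_corr \<mu> n n k n n k' = wig_corr \<mu> n j k n j k'" if "j \<le> n" for j
    unfolding wig_corr_schur[OF assms(1) order_refl that assms(2) that assms(3) refl] by simp
  then have "(\<Sum>j\<le>n. wig_corr \<mu> n n k n n k') = (\<Sum>j\<le>n. wig_corr \<mu> n j k n j k')"
    by (intro sum.cong) auto
  then have "of_nat (n + 1) * wig_corr \<mu> n n k n n k' = (\<Sum>j\<le>n. wig_corr \<mu> n j k n j k')"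
    by simp
  also have "\<dots> = (LINT g|\<mu>. (\<Sum>j\<le>n. wig n j k g * cnj (wig n j k' g)))"
    unfolding wig_corr_def
    by (subst Bochner_Integration.integral_sum) (auto intro!: integrable_wig_mult_cnj assms)
  also have "\<dots> = (LINT g|\<mu>. of_bool (k = k'))"
    by (rule Bochner_Integration.integral_cong)
      (auto simp: haar_space[OF assms(1)] wig_columns_orthonormal assms)
  finally show ?thesis
    by (simp add: field_simps prob_space del: of_nat_Suc)
qed

lemma wig_corr_eq:
  assumes "is_haar_prob_SU2 \<mu>" "j \<le> n" "k \<le> n" "j' \<le> n'" "k' \<le> n'"
  shows "wig_corr \<mu> n j k n' j' k' = of_bool (n = n' \<and> k = k' \<and> j = j') / of_nat (n + 1)"
proof -
  have *: "wig_corr \<mu> n j k n' j' k' = of_bool (n = n' \<and> k = k' \<and> j = j') / of_nat (n + 1)"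
    if "n \<le> n'" "j \<le> n" "k \<le> n" "j' \<le> n'" "k' \<le> n'" for n j k n' j' k'
  proof (cases "2 * j + n' = 2 * j' + n")
    case True
    then show ?thesis
      using wig_corr_schur[OF assms(1) that True] wig_corr_trace[OF assms(1), of k n k'] that
      by auto
  next
    case False
    then show ?thesis
      using wig_corr_off_diagonal[OF assms(1) that(2-5) False] by auto
  qed
  show ?thesis
  proof (cases "n \<le> n'")
    case True
    then show ?thesis using * assms by blast
  next
    case False
    then show ?thesis
      using *[of n' n j' k' j k] assms by (subst wig_corr_cnj) auto
  qed
qed

section \<open>Return to the original indices\<close>

theorem theorem10:
  fixes M :: "'w measure" and \<gamma> :: "'w \<Rightarrow> complex^2^2"
    and l l' m s m' s' :: real
  assumes "prob_space M"
    and "\<gamma> \<in> measurable M borel_SU2"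
    and "is_haar_prob_SU2 (distr M borel_SU2 \<gamma>)"
    and "l \<in> half_nats" and "l' \<in> half_nats"
    and "m \<in> wigner_indices l" and "s \<in> wigner_indices l"
    and "m' \<in> wigner_indices l'" and "s' \<in> wigner_indices l'"
  shows "integrable M (\<lambda>\<omega>. wigner_D l m s (\<gamma> \<omega>) * cnj (wigner_D l' m' s' (\<gamma> \<omega>))) \<and>
         prob_space.expectation M
           (\<lambda>\<omega>. wigner_D l m s (\<gamma> \<omega>) * cnj (wigner_D l' m' s' (\<gamma> \<omega>))) =
         of_bool (l = l') * of_bool (s = s') * of_bool (m = m') / complex_of_real (2 * l + 1) \<and>
         integrable M (\<lambda>\<omega>. wigner_D l m s (\<gamma> \<omega>) * wigner_D l' m' s' (\<gamma> \<omega>)) \<and>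
         prob_space.expectation M
           (\<lambda>\<omega>. wigner_D l m s (\<gamma> \<omega>) * wigner_D l' m' s' (\<gamma> \<omega>)) =
         of_bool (l = l') * of_bool (- s = s') * of_bool (- m = m') * (- 1) powi \<lfloor>- m + s\<rfloor>
         / complex_of_real (2 * l + 1)"
proof -
  obtain n n' where l: "l = real n / 2" "l' = real n' / 2"
    using assms(4,5) by (auto simp: half_nats_def)
  obtain j where j: "j \<le> n" "m = real j - real n / 2"
    using assms(6) unfolding l by (rule wigner_indicesE)
  obtain k where k: "k \<le> n" "s = real k - real n / 2"
    using assms(7) unfolding l by (rule wigner_indicesE)
  obtain j' where j': "j' \<le> n'" "m' = real j' - real n' / 2"
    using assms(8) unfolding l by (rule wigner_indicesE)
  obtain k' where k': "k' \<le> n'" "s' = real k' - real n' / 2"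
    using assms(9) unfolding l by (rule wigner_indicesE)
  have D: "wigner_D l m s g = wig n j k g" "wigner_D l' m' s' g = wig n' j' k' g" for g
    by (simp_all add: wig_def l j k j' k')
  have meas: "(\<lambda>g. wig n j k g * cnj (wig n' i i' g)) \<in> borel_measurable borel_SU2"
    if "i \<le> n'" "i' \<le> n'" for i i'
    by (intro borel_measurable_times wig_borel_measurable j(1) k(1) that)
  have int: "integrable M (\<lambda>\<omega>. wig n j k (\<gamma> \<omega>) * cnj (wig n' i i' (\<gamma> \<omega>)))"
    if "i \<le> n'" "i' \<le> n'" for i i'
    using integrable_wig_mult_cnj[OF assms(3) j(1) k(1) that]
    unfolding integrable_distr_eq[OF assms(2) meas[OF that]] .
  have E: "prob_space.expectation M (\<lambda>\<omega>. wig n j k (\<gamma> \<omega>) * cnj (wig n' i i' (\<gamma> \<omega>))) =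
      of_bool (n = n' \<and> k = i' \<and> j = i) / of_nat (n + 1)"
    if "i \<le> n'" "i' \<le> n'" for i i'
    using wig_corr_eq[OF assms(3) j(1) k(1) that]
    unfolding wig_corr_def integral_distr[OF assms(2) meas[OF that]] .
  \<comment> \<open>The second product becomes a correlation with the entry whose original indices
    are \<open>-m'\<close> and \<open>-s'\<close>.\<close>
  have sym: "wig n j k g * wig n' j' k' g =
      (- 1) ^ (j' + k') * (wig n j k g * cnj (wig n' (n' - j') (n' - k') g))" for g
    by (subst wig_symmetry[OF j'(1) k'(1)]) (simp add: mult_ac)
  have cond: "n = n' \<and> k = k' \<and> j = j' \<longleftrightarrow> l = l' \<and> s = s' \<and> m = m'"
    "n = n' \<and> k = n' - k' \<and> j = n' - j' \<longleftrightarrow> l = l' \<and> - s = s' \<and> - m = m'"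
    using j k j' k' by (auto simp: l)
  \<comment> \<open>Where the deltas do not vanish, \<open>j' + k' = 2 * n - (j + k)\<close> has the
    parity of \<open>k - j = s - m\<close>. As \<open>2 * n\<close> is even, no factor
    \<open>(-1)^(2 * l)\<close> remains.\<close>
  have sign: "(- 1) ^ (j' + k') = ((- 1) powi \<lfloor>- m + s\<rfloor> :: complex)"
    if "n = n' \<and> k = n' - k' \<and> j = n' - j'"
  proof -
    have "\<lfloor>- m + s\<rfloor> = int k - int j"
      by (simp add: j k floor_eq_iff)
    then show ?thesis
      using that j' k' by (simp add: power_int_minus_left minus_one_power_iff)
  qed
  have den: "complex_of_real (2 * l + 1) = of_nat (n + 1)"
    by (simp add: l)
  have "n' - j' \<le> n'" "n' - k' \<le> n'"
    by simp_all
  note int' = int[OF this] and E' = E[OF this]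
  show ?thesis
    unfolding D sym den Bochner_Integration.integral_mult_right_zero
      E[OF j'(1) k'(1)] E' cond of_bool_conj[symmetric]
    using int[OF j'(1) k'(1)] int' sign unfolding cond
    by (auto intro!: integrable_mult_right)
qed

end
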